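(* Let $L$ be an irreducible almost lower-triangular transition matrix on $\mathbb N$. For $n\ge0$ let $L^{(n)}$ be the projected transition matrix on $[0,n]$ defined by $$L^{(n)}_{i,j}=L_{i,j}\ \ (0\le i\le n,\ 0\le j\le n-1),\qquad L^{(n)}_{i,n}=\sum_{j\ge n}L_{i,j}\ \ (0\le i\le n),$$ let $\rho^{(n)}$ be the invariant probability distribution of $L^{(n)}$, and set $\eta^{(n)}_a=\rho^{(n)}_a/\rho^{(n)}_0$ for $a\ge0$ (with $\rho^{(n)}_a=0$ for $a>n$, and assuming $\rho_0^{(n)}>0$ so that these quotients are defined). Suppose that the three following conditions hold: (a) there exists a non-negative sequence $(S_a,a\ge0)$ such that, for each $b$, $\sum_{a:\,a\ge b+1}S_aL_{a,b}<+\infty$, and $|\eta^{(n)}_a|\le S_a$ for all $a,n\ge0$; (b) $\eta_a:=\lim_{n\to+\infty}\eta^{(n)}_a$ exists for each $a$; (c) for every $a$, $\eta^{(n)}_n\sum_{j\ge n}L_{j,a}\to0$ as $n\to+\infty$. Then $\eta=(\eta_a,a\ge0)$ is invariant by $L$.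
   Context: $\mathbb N=\{0,1,2,\dots\}$, $[0,n]=\{0,\dots,n\}$. A transition matrix $L=[L_{i,j}]_{i,j\ge0}$ on $\mathbb N$ (non-negative entries, rows summing to $1$) is almost lower-triangular if $L_{i,j}>0\Rightarrow j\le i+1$. A measure $\eta$ is invariant by $L$ if $\sum_a\eta_aL_{a,b}=\eta_b$ for all $b\in\mathbb{N}$. *)

theory Defs
  imports "HOL-Analysis.Analysis"
begin

definition transition_matrix :: "(nat \<Rightarrow> nat \<Rightarrow> real) \<Rightarrow> bool" where
  "transition_matrix L \<longleftrightarrow> (\<forall>i j. 0 \<le> L i j) \<and> (\<forall>i. (L i has_sum 1) UNIV)"

definition almost_lower_triangular :: "(nat \<Rightarrow> nat \<Rightarrow> real) \<Rightarrow> bool" where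
  "almost_lower_triangular L \<longleftrightarrow> (\<forall>i j. L i j > 0 \<longrightarrow> j \<le> i + 1)"

primrec matrix_power :: "(nat \<Rightarrow> nat \<Rightarrow> real) \<Rightarrow> nat \<Rightarrow> nat \<Rightarrow> nat \<Rightarrow> real" where
  "matrix_power L 0 = (\<lambda>i j. if i = j then 1 else 0)"
| "matrix_power L (Suc m) = (\<lambda>i j. \<Sum>\<^sub>\<infinity>k. L i k * matrix_power L m k j)"

definition irreducible_matrix :: "(nat \<Rightarrow> nat \<Rightarrow> real) \<Rightarrow> bool" where
  "irreducible_matrix L \<longleftrightarrow> (\<forall>i j. \<exists>m. matrix_power L m i j > 0)"

(* Only the entries with indices in {..n} are meaningful; the others are set to 0. *)
definition projected_matrix :: "(nat \<Rightarrow> nat \<Rightarrow> real) \<Rightarrow> nat \<Rightarrow> nat \<Rightarrow> nat \<Rightarrow> real" where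
  "projected_matrix L n i j =
     (if i \<le> n \<and> j < n then L i j
      else if i \<le> n \<and> j = n then (\<Sum>\<^sub>\<infinity>k\<in>{n..}. L i k)
      else 0)"

(* A distribution on {..n} is represented by its extension by zero to all of nat. *)
definition invariant_distribution_upto ::
    "nat \<Rightarrow> (nat \<Rightarrow> nat \<Rightarrow> real) \<Rightarrow> (nat \<Rightarrow> real) \<Rightarrow> bool" where
  "invariant_distribution_upto n P r \<longleftrightarrow>
     (\<forall>a. 0 \<le> r a) \<and> (\<forall>a>n. r a = 0) \<and> (\<Sum>a\<le>n. r a) = 1 \<and>
     (\<forall>b\<le>n. (\<Sum>a\<le>n. r a * P a b) = r b)"

definition normalized_at_zero :: "(nat \<Rightarrow> real) \<Rightarrow> nat \<Rightarrow> real" where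
  "normalized_at_zero r a = r a / r 0"

definition invariant_measure :: "(nat \<Rightarrow> nat \<Rightarrow> real) \<Rightarrow> (nat \<Rightarrow> real) \<Rightarrow> bool" where
  "invariant_measure L \<eta> \<longleftrightarrow>
     (\<forall>a. 0 \<le> \<eta> a) \<and> (\<forall>b. ((\<lambda>a. \<eta> a * L a b) has_sum \<eta> b) UNIV)"

end

theory Submission imports Defs begin

text \<open>
  The projection onto \<open>{..n}\<close> alters only the last column: in every column \<open>b < n\<close> the projected
  matrix agrees with \<open>L\<close>. Hence the normalized distribution \<open>\<eta>\<^sup>n\<close>, extended by zero, already
  satisfies the invariance equation of the unprojected matrix at every state \<open>b < n\<close>:
  \<open>\<eta>\<^sup>n\<^sub>b = (\<Sum>a. \<eta>\<^sup>n\<^sub>a * L\<^sub>a\<^sub>b)\<close>, a sum with finite support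
  (lemma \<open>normalized_projected_invariant\<close>).

  For fixed \<open>b\<close> this holds for all large \<open>n\<close>, and it remains to let \<open>n\<close> tend to infinity under
  the sum. The terms are dominated by \<open>S\<^sub>a * L\<^sub>a\<^sub>b\<close>, which is summable over \<open>a \<ge> b + 1\<close> by hypothesis
  and so over all \<open>a\<close>. Dominated convergence for series, that is, Tannery's theorem, then gives
  \<open>\<eta>\<^sub>b = (\<Sum>a. \<eta>\<^sub>a * L\<^sub>a\<^sub>b)\<close>.
\<close>

text \<open>
  Only column \<open>n\<close> of the projected matrix collects mass from other columns of \<open>L\<close>, and the
  invariance equation is homogeneous, so it survives the normalization. Stating it as an infinite
  series gives all \<open>n\<close> the same index set, as dominated convergence requires.
\<close>
lemma normalized_projected_invariant:
  assumes "invariant_distribution_upto n (projected_matrix L n) r" and "b < n"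
  shows "(\<lambda>a. normalized_at_zero r a * L a b) sums normalized_at_zero r b"
proof -
  have zero: "r a = 0" if "a > n" for a
    using assms(1) that by (simp add: invariant_distribution_upto_def)
  have "r b = (\<Sum>a\<le>n. r a * projected_matrix L n a b)"
    using assms by (simp add: invariant_distribution_upto_def)
  also have "\<dots> = (\<Sum>a\<le>n. r a * L a b)"
    using \<open>b < n\<close> by (intro sum.cong) (auto simp: projected_matrix_def)
  finally have "normalized_at_zero r b = (\<Sum>a\<le>n. normalized_at_zero r a * L a b)"
    by (simp add: normalized_at_zero_def sum_divide_distrib)
  moreover have "(\<lambda>a. normalized_at_zero r a * L a b) sums
      (\<Sum>a\<le>n. normalized_at_zero r a * L a b)"
    using zero by (intro sums_finite) (auto simp: normalized_at_zero_def)
  ultimately show ?thesis by simp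
qed

theorem proposition2p17:
  fixes L :: "nat \<Rightarrow> nat \<Rightarrow> real"
    and \<rho> :: "nat \<Rightarrow> nat \<Rightarrow> real"
    and \<eta> :: "nat \<Rightarrow> real"
  assumes "transition_matrix L"
    and "irreducible_matrix L"
    and "almost_lower_triangular L"
    and "\<And>n. invariant_distribution_upto n (projected_matrix L n) (\<rho> n)"
    and "\<And>n. \<rho> n 0 > 0"
    and a: "\<exists>S :: nat \<Rightarrow> real. (\<forall>a. 0 \<le> S a) \<and>
              (\<forall>b. (\<lambda>a. S a * L a b) summable_on {b + 1..}) \<and>
              (\<forall>a n. \<bar>normalized_at_zero (\<rho> n) a\<bar> \<le> S a)"
    and b: "\<And>a. (\<lambda>n. normalized_at_zero (\<rho> n) a) \<longlonglongrightarrow> \<eta> a"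
    and c: "\<And>a. (\<lambda>n. ennreal (normalized_at_zero (\<rho> n) n) *
                     (\<Sum>\<^sub>\<infinity>j\<in>{n..}. ennreal (L j a))) \<longlonglongrightarrow> 0"
  shows "invariant_measure L \<eta>"
proof -
  obtain S :: "nat \<Rightarrow> real" where
    S_summable: "\<And>b. (\<lambda>a. S a * L a b) summable_on {b + 1..}" and
    S_bound: "\<And>a n. \<bar>normalized_at_zero (\<rho> n) a\<bar> \<le> S a"
    using a by auto
  have L_nonneg: "0 \<le> L i j" for i j
    using assms(1) by (simp add: transition_matrix_def)
  have \<eta>_nonneg: "0 \<le> \<eta> i" for i
  proof (rule LIMSEQ_le_const[OF b])
    have "0 \<le> normalized_at_zero (\<rho> n) i" for n
      using assms(4)[of n] by (simp add: normalized_at_zero_def invariant_distribution_upto_def)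
    then show "\<exists>N. \<forall>n\<ge>N. 0 \<le> normalized_at_zero (\<rho> n) i" by blast
  qed
  have "((\<lambda>i. \<eta> i * L i j) has_sum \<eta> j) UNIV" for j
  proof -
    have "(\<lambda>i. S i * L i j) summable_on ({..j} \<union> {j + 1..})"
      using S_summable by (intro summable_on_union) auto
    also have "{..j} \<union> {j + 1..} = UNIV" by auto
    finally have dominating: "summable (\<lambda>i. S i * L i j)"
      by (rule summable_on_imp_summable)
    have bound: "norm (normalized_at_zero (\<rho> n) i * L i j) \<le> S i * L i j" for n i
      using S_bound[of n i] L_nonneg[of i j] by (simp add: abs_mult mult_right_mono)
    have limits: "(\<lambda>n. normalized_at_zero (\<rho> n) i * L i j) \<longlonglongrightarrow> \<eta> i * L i j" for i
      by (intro tendsto_intros b)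
    have "eventually (\<lambda>(i, n). norm (normalized_at_zero (\<rho> n) i * L i j) \<le> S i * L i j)
        (at_top \<times>\<^sub>F sequentially)"
      using bound by (intro always_eventually) auto
    from tannerys_theorem[OF limits this dominating]
    have Tannery: "summable (\<lambda>i. norm (\<eta> i * L i j))"
      "(\<lambda>n. \<Sum>i. normalized_at_zero (\<rho> n) i * L i j) \<longlonglongrightarrow> (\<Sum>i. \<eta> i * L i j)"
      by simp_all
    have "eventually (\<lambda>n. (\<Sum>i. normalized_at_zero (\<rho> n) i * L i j)
        = normalized_at_zero (\<rho> n) j) sequentially"
      using eventually_gt_at_top[of j]
      by eventually_elim (metis normalized_projected_invariant assms(4) sums_unique)
    with Tannery(2) have "(\<lambda>n. normalized_at_zero (\<rho> n) j) \<longlonglongrightarrow> (\<Sum>i. \<eta> i * L i j)"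
      by (rule Lim_transform_eventually)
    with b have "(\<Sum>i. \<eta> i * L i j) = \<eta> j"
      using LIMSEQ_unique by blast
    with Tannery(1) have "(\<lambda>i. \<eta> i * L i j) sums \<eta> j"
      by (metis summable_norm_cancel summable_sums)
    with Tannery(1) show ?thesis
      by (rule norm_summable_imp_has_sum)
  qed
  with \<eta>_nonneg show ?thesis
    by (simp add: invariant_measure_def)
qed

end
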